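(* Let $(\mathcal X,m)$ be a metric space, $\mu$ a finite positive Borel measure supported on $\mathcal X$, and $X_N=\{x_1,\dots,x_N\}$ a set of $N$ points independently and randomly distributed over $\mathcal X$ with respect to $\mu$. Assume the function $\Phi$ on $(0,\infty)$ is continuous, non-negative, strictly increasing, strictly doubling (i.e., for some constants $C_1,C_2>1$ and any small $r>0$, $C_1\Phi(r)\leq\Phi(2r)\leq C_2\Phi(r)$), and that there exist positive numbers $r_0$ and $\sigma$ such that $\Phi(r)\leq r^\sigma$ for every $0<r<r_0$. If for some positive constants $c,C$, any $x\in\mathcal X$ and every $0<r<r_0$ we have $$c\,\Phi(r)\leq\mu(B(x,r))\leq C\,\Phi(r),$$ then there exist positive constants $c_1,c_2,c_3,c_4$ such that for any $\varepsilon>0$ there is a number $N(\varepsilon)$ such that for any $N>N(\varepsilon)$ we have $$\mathbb P\left[c_1\Phi^{-1}\left(c_2\frac{\log N}{N}\right)\leq\rho(X_N,\mathcal X)\leq c_3\Phi^{-1}\left(c_4\frac{\log N}{N}\right)\right]>1-\varepsilon.$$ Moreover, there exist positive constants $C_1',C_2',C_3',C_4'$ (not depending on $N$) such that for all sufficiently large $N$ $$C_1'\Phi^{-1}\left(C_2'\frac{\log N}{N}\right)\leq\mathbb E\rho(X_N,\mathcal X)\leq C_3'\Phi^{-1}\left(C_4'\frac{\log N}{N}\right).$$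
   Context: $B(x,r)=\{y\in\mathcal X: m(y,x)\le r\}$ denotes the closed ball. The covering radius of $X_N$ with respect to $\mathcal X$ is $\rho(X_N,\mathcal X):=\sup_{y\in\mathcal X}\inf_{j} m(y,x_j)$. A point is randomly distributed over $\mathcal X$ with respect to $\mu$ if its law is the probability measure $\mu/\mu(\mathcal X)$. $\mathbb P$ and $\mathbb E$ denote probability and expectation with respect to the random choice of $X_N$. $\Phi^{-1}$ is the inverse of $\Phi$, defined on the range of $\Phi$. *)

theory Defs
  imports "HOL-Probability.Probability"
begin

text \<open>The supremum and infimum are taken in the reals, so the value is meaningful only if
  \<open>A\<close> is nonempty and \<open>S\<close> is nonempty and bounded.  A finite measure
  whose balls of a fixed radius have mass bounded away from zero forces the space to be totally
  bounded, so this is the case wherever the definition is used below.\<close>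

definition covering_radius :: "'a::metric_space set \<Rightarrow> 'a set \<Rightarrow> real" where
  "covering_radius A S = (SUP y\<in>S. INF x\<in>A. dist y x)"

text \<open>The joint law of \<open>N\<close> independent points \<open>x 1, \<dots>, x N\<close>, each with law
  \<open>\<mu> / \<mu>(space \<mu>)\<close>.\<close>

definition random_points :: "'a measure \<Rightarrow> nat \<Rightarrow> (nat \<Rightarrow> 'a) measure" where
  "random_points \<mu> N =
     PiM {1..N} (\<lambda>_. scale_measure (inverse (emeasure \<mu> (space \<mu>))) \<mu>)"

definition strictly_doubling :: "(real \<Rightarrow> real) \<Rightarrow> bool" where
  "strictly_doubling \<Phi> \<longleftrightarrow>
     (\<exists>C1>1. \<exists>C2>1. \<forall>\<^sub>F r in at_right 0. C1 * \<Phi> r \<le> \<Phi> (2 * r) \<and> \<Phi> (2 * r) \<le> C2 * \<Phi> r)"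

text \<open>The inverse of \<open>\<Phi>\<close> as a function on \<open>(0, \<infinity>)\<close>; values outside the range
  \<open>\<Phi> ` {0<..}\<close> are unspecified.\<close>

definition pos_inv :: "(real \<Rightarrow> real) \<Rightarrow> real \<Rightarrow> real" where
  "pos_inv \<Phi> = inv_into {0<..} \<Phi>"

end

theory Submission
  imports Defs "HOL-Real_Asymp.Real_Asymp"
begin

text \<open>
  Normalise \<open>\<mu>\<close> to a probability measure \<open>\<nu>\<close>; then balls of small radius \<open>r\<close> have
  \<open>\<nu>\<close>-mass comparable to \<open>\<Phi> r\<close>.  Everything happens at a scale \<open>r\<close> with
  \<open>\<Phi> r = \<kappa> * ln N / N\<close>, and the choice of \<open>\<kappa>\<close> decides which of two effects wins.

  Take a maximal set \<open>Z\<close> of points with mutual distances exceeding \<open>2 * r\<close>.  The balls of radius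
  \<open>r\<close> about \<open>Z\<close> are disjoint and those of radius \<open>2 * r\<close> cover the space, so
  comparing masses gives \<open>card Z\<close> of order \<open>1 / \<Phi> r\<close>, that is, of order \<open>N / ln N\<close>; here
  doubling bounds \<open>\<Phi> (2 * r)\<close> by a multiple of \<open>\<Phi> r\<close>.
  A given small ball is missed by all \<open>N\<close> random points with probability about
  \<open>exp (- N * \<Phi> r) = N powr (- \<kappa>)\<close>, up to constants in the exponent.

  For large \<open>\<kappa>\<close> the union bound shows that with high probability no ball about \<open>Z\<close> is missed,
  and then every point of the space is within \<open>3 * r\<close> of a sample point
  (\<open>prob_covering_radius_gt\<close>).  For small \<open>\<kappa>\<close> the expected number of missed balls tends to
  infinity.  Because the balls are disjoint, the events of missing them are negatively correlated,
  so the second moment method yields that some ball is missed with high probability, which forces the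
  covering radius to be at least \<open>r\<close> (\<open>prob_covering_radius_less\<close>).

  The expectation is bounded below by Markov's inequality.  It is bounded above by \<open>3 * r\<close> plus the
  diameter times the probability of the bad event.  That probability can be made as small as any power
  of \<open>1 / N\<close> by enlarging \<open>\<kappa>\<close>, whereas \<open>\<Phi> r \<le> r powr \<sigma>\<close> keeps \<open>r\<close> above a
  multiple of \<open>N powr (- 1 / \<sigma>)\<close>; hence the second summand is absorbed by \<open>r\<close>.
\<close>

section \<open>Two elementary inequalities\<close>

lemma exp_minus_double_le:
  fixes u :: real
  assumes "0 \<le> u" "u \<le> 1 / 2"
  shows "exp (- 2 * u) \<le> 1 - u"
proof -
  have "1 \<le> (1 + 2 * u) * (1 - u)"
    using assms mult_nonneg_nonneg[of u "1 - 2 * u"] by (simp add: algebra_simps)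
  also have "\<dots> \<le> exp (2 * u) * (1 - u)"
    using assms by (intro mult_right_mono) auto
  finally show ?thesis by (simp add: exp_minus field_simps)
qed


text \<open>
  The second moment method.  The number of events that occur has mean
  \<open>S = (\<Sum>i\<in>I. prob (E i))\<close>, and without positive correlations its variance is at most \<open>S\<close>, as
  only the diagonal terms of the second moment can exceed the corresponding products of means.  When no event
  occurs, this number deviates from its mean by \<open>S\<close>, which Chebyshev's inequality bounds.
\<close>

lemma (in prob_space) prob_no_event_le:
  fixes E :: "'i \<Rightarrow> 'a set"
  assumes "finite I"
    and events: "\<And>i. i \<in> I \<Longrightarrow> E i \<in> events"
    and neg_cor: "\<And>i j. i \<in> I \<Longrightarrow> j \<in> I \<Longrightarrow> i \<noteq> j \<Longrightarrow> prob (E i \<inter> E j) \<le> prob (E i) * prob (E j)"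
    and pos: "0 < (\<Sum>i\<in>I. prob (E i))"
  shows "prob (space M - (\<Union>i\<in>I. E i)) \<le> 1 / (\<Sum>i\<in>I. prob (E i))"
proof -
  define S where "S = (\<Sum>i\<in>I. prob (E i))"
  define f :: "'a \<Rightarrow> real" where "f = (\<lambda>x. \<Sum>i\<in>I. indicator (E i) x)"
  note events [measurable]
  have int_ind: "integrable M (indicator (A) :: 'a \<Rightarrow> real)" if "A \<in> events" for A
    using that by (simp add: integrable_indicator_iff less_top[symmetric])
  have f_meas [measurable]: "f \<in> borel_measurable M"
    unfolding f_def by (intro borel_measurable_sum borel_measurable_indicator events)
  have f_square: "(f x)\<^sup>2 = (\<Sum>i\<in>I. \<Sum>j\<in>I. indicator (E i \<inter> E j) x)" for x
    by (simp add: f_def power2_eq_square sum_product indicator_inter_arith)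
  have int_square: "integrable M (\<lambda>x. (f x)\<^sup>2)"
    unfolding f_square by (intro Bochner_Integration.integrable_sum int_ind sets.Int events)
  have exp_f: "expectation f = S"
    unfolding f_def S_def using events int_ind
    by (subst Bochner_Integration.integral_sum) (auto intro!: sum.cong)
  have "expectation (\<lambda>x. (f x)\<^sup>2) = (\<Sum>i\<in>I. \<Sum>j\<in>I. prob (E i \<inter> E j))"
    unfolding f_square using events int_ind
    by (subst Bochner_Integration.integral_sum, force,
        auto intro!: sum.cong simp: Bochner_Integration.integral_sum)
  also have "\<dots> \<le> (\<Sum>i\<in>I. \<Sum>j\<in>I. prob (E i) * prob (E j) + (if i = j then prob (E i) else 0))"
    by (intro sum_mono) (auto simp: neg_cor)
  also have "\<dots> = S\<^sup>2 + S"
    using \<open>finite I\<close> by (simp add: sum.distrib S_def power2_eq_square sum_product)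
  finally have var: "variance f \<le> S"
    using int_square by (subst variance_eq) (auto simp: exp_f square_integrable_imp_integrable)
  have "prob (space M - (\<Union>i\<in>I. E i)) \<le> prob {x \<in> space M. S \<le> \<bar>f x - expectation f\<bar>}"
  proof (rule finite_measure_mono)
    show "space M - (\<Union>i\<in>I. E i) \<subseteq> {x \<in> space M. S \<le> \<bar>f x - expectation f\<bar>}"
    proof
      fix x assume "x \<in> space M - (\<Union>i\<in>I. E i)"
      then have "x \<in> space M" "f x = 0" by (auto simp: f_def)
      then show "x \<in> {x \<in> space M. S \<le> \<bar>f x - expectation f\<bar>}"
        by (simp add: exp_f)
    qed
  qed measurable
  also have "\<dots> \<le> variance f / S\<^sup>2"
    by (rule Chebyshev_inequality) (use pos int_square in \<open>auto simp: S_def\<close>)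
  also have "\<dots> \<le> S / S\<^sup>2"
    by (intro divide_right_mono var) auto
  also have "\<dots> = 1 / S"
    using pos by (simp add: S_def power2_eq_square)
  finally show ?thesis
    by (simp add: S_def)
qed

section \<open>Spaces with uniformly charged balls\<close>

text \<open>
  The lower bound on the mass of balls, uniform in the centre, is what makes the space totally
  bounded.  This has two consequences.  The covering radius is a supremum of a bounded
  function, so it is meaningful.  And the space has a countable dense subset, which yields measurability
  of the covering radius although the type is not assumed to be second countable.
\<close>

locale charged_balls = prob_space M for M :: "'a::metric_space measure" +
  assumes sets_M [measurable_cong]: "sets M = sets borel"
    and charged: "0 < r \<Longrightarrow> \<exists>p>0. \<forall>x. p \<le> prob (cball x r)"
begin

lemma space_M [simp]: "space M = UNIV"
  using sets_eq_imp_space_eq[OF sets_M] by simp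

lemma separated_card_le:
  fixes Z :: "'a set"
  assumes "finite Z"
    and sep: "\<And>z w. z \<in> Z \<Longrightarrow> w \<in> Z \<Longrightarrow> z \<noteq> w \<Longrightarrow> 2 * r < dist z w"
    and p: "\<And>x. p \<le> prob (cball x r)"
  shows "real (card Z) * p \<le> 1"
proof -
  have disj: "disjoint_family_on (\<lambda>z. cball z r) Z"
    unfolding disjoint_family_on_def using sep by (auto intro!: disjoint_cballI)
  have "real (card Z) * p \<le> (\<Sum>z\<in>Z. prob (cball z r))"
    using sum_mono[of Z "\<lambda>_. p" "\<lambda>z. prob (cball z r)"] p by simp
  also have "\<dots> = prob (\<Union>z\<in>Z. cball z r)"
    by (rule finite_measure_finite_Union[symmetric]) (use assms disj in \<open>auto simp: sets_M\<close>)
  also have "\<dots> \<le> 1" by simp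
  finally show ?thesis .
qed

text \<open>
  Separated sets have bounded cardinality, so one of maximal cardinality exists; a point violating
  the covering property could be added to it.
\<close>

lemma maximal_separated_set:
  assumes "0 < r"
  obtains Z :: "'a set" where "finite Z"
    and "\<And>z w. z \<in> Z \<Longrightarrow> w \<in> Z \<Longrightarrow> z \<noteq> w \<Longrightarrow> 2 * r < dist z w"
    and "\<And>y. \<exists>z\<in>Z. dist y z \<le> 2 * r"
proof -
  define sep where "sep = (\<lambda>Z::'a set. finite Z \<and> (\<forall>z\<in>Z. \<forall>w\<in>Z. z \<noteq> w \<longrightarrow> 2 * r < dist z w))"
  obtain p where p: "p > 0" "\<And>x. p \<le> prob (cball x r)"
    using charged[OF assms] by blast
  have bound: "card Z < Suc (nat \<lfloor>1 / p\<rfloor>)" if "sep Z" for Z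
  proof -
    have "real (card Z) * p \<le> 1"
      using that p(2) by (intro separated_card_le[where r = r]) (auto simp: sep_def)
    then have "card Z \<le> 1 / p"
      using p(1) by (simp add: field_simps)
    then show ?thesis
      by (simp add: less_Suc_eq_le le_nat_floor)
  qed
  have "sep {}" by (simp add: sep_def)
  then obtain Z where Z: "sep Z" "\<And>W. sep W \<Longrightarrow> card W \<le> card Z"
    using ex_has_greatest_nat[of sep "{}" card "Suc (nat \<lfloor>1 / p\<rfloor>)"] bound by (meson less_imp_le)
  show thesis
  proof (rule that[of Z])
    show "\<exists>z\<in>Z. dist y z \<le> 2 * r" for y
    proof (rule ccontr)
      assume far: "\<not> ?thesis"
      then have "y \<notin> Z" using assms by force
      moreover have "sep (insert y Z)"
        using far Z(1) by (auto simp: sep_def dist_commute not_le)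
      ultimately show False
        using Z(2)[of "insert y Z"] Z(1) by (simp add: sep_def)
    qed
  qed (use Z in \<open>auto simp: sep_def\<close>)
qed

lemma bounded_UNIV: "bounded (UNIV :: 'a set)"
proof -
  obtain Z where Z: "finite Z" "\<And>y::'a. \<exists>z\<in>Z. dist y z \<le> 2 * (1::real)"
    using maximal_separated_set[of 1] by (metis zero_less_one)
  have "bounded (\<Union>z\<in>Z. cball z 2)"
    using Z(1) by auto
  then show ?thesis
    by (rule bounded_subset) (use Z(2) in \<open>force simp: dist_commute\<close>)
qed

lemma countable_dense:
  obtains D :: "'a set" where "countable D" "D \<noteq> {}" "\<And>y e. 0 < e \<Longrightarrow> \<exists>d\<in>D. dist y d < e"
proof -
  have "\<exists>Z. finite Z \<and> (\<forall>y::'a. \<exists>z\<in>Z. dist y z \<le> 2 * (1 / real (Suc n)))" for n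
    using maximal_separated_set[of "1 / real (Suc n)"] by (metis of_nat_0_less_iff zero_less_Suc zero_less_divide_1_iff)
  then obtain Z where Z: "\<And>n. finite (Z n)"
    "\<And>n y::'a. \<exists>z\<in>Z n. dist y z \<le> 2 * (1 / real (Suc n))"
    by metis
  show thesis
  proof (rule that[of "\<Union>n. Z n"])
    show "countable (\<Union>n. Z n)" using Z(1) by (auto simp: countable_finite)
    show "(\<Union>n. Z n) \<noteq> {}" using Z(2) by fast
    show "\<exists>d\<in>(\<Union>n. Z n). dist y d < e" if "0 < e" for y e
    proof -
      have "0 < e / 2" using \<open>0 < e\<close> by simp
      then obtain n where "1 / real (Suc n) < e / 2"
        by (rule nat_approx_posE)
      then have "2 * (1 / real (Suc n)) < e" by linarith
      then show ?thesis using Z(2)[of n y] by (meson UNIV_I UN_I le_less_trans)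
    qed
  qed
qed

section \<open>The covering radius of a sample\<close>

lemma covering_radius_eq_SUP_infdist:
  fixes A :: "'a set"
  assumes "A \<noteq> {}"
  shows "covering_radius A UNIV = (SUP y. infdist y A)"
  using assms by (simp add: covering_radius_def infdist_def)

lemma infdist_le_diameter:
  fixes A :: "'a set"
  assumes "A \<noteq> {}"
  shows "infdist y A \<le> diameter (UNIV :: 'a set)"
proof -
  obtain a where "a \<in> A" using assms by auto
  then have "infdist y A \<le> dist y a" by (rule infdist_le)
  also have "\<dots> \<le> diameter (UNIV :: 'a set)"
    by (rule diameter_bounded_bound[OF bounded_UNIV]) auto
  finally show ?thesis .
qed

lemma bdd_above_infdist: "(A :: 'a set) \<noteq> {} \<Longrightarrow> bdd_above (range (\<lambda>y::'a. infdist y A))"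
  by (rule bdd_aboveI2) (rule infdist_le_diameter)

lemma covering_radius_le_diameter:
  "(A :: 'a set) \<noteq> {} \<Longrightarrow> covering_radius A UNIV \<le> diameter (UNIV :: 'a set)"
  unfolding covering_radius_eq_SUP_infdist by (rule cSUP_least) (auto intro: infdist_le_diameter)

lemma infdist_le_covering_radius: "(A :: 'a set) \<noteq> {} \<Longrightarrow> infdist y A \<le> covering_radius A UNIV"
  unfolding covering_radius_eq_SUP_infdist by (rule cSUP_upper) (auto intro: bdd_above_infdist)

lemma covering_radius_nonneg: "(A :: 'a set) \<noteq> {} \<Longrightarrow> 0 \<le> covering_radius A UNIV"
  using infdist_nonneg infdist_le_covering_radius order_trans by blast

text \<open>
  The distance to a fixed set is 1-Lipschitz, so the supremum may be taken over a countable dense set.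
\<close>

lemma covering_radius_measurable:
  fixes N :: nat
  assumes "1 \<le> N"
  shows "(\<lambda>x. covering_radius (x ` {1..N}) UNIV) \<in> borel_measurable (PiM {1..N} (\<lambda>_. M))"
proof -
  obtain D :: "'a set" where D: "countable D" "D \<noteq> {}" "\<And>y e. 0 < e \<Longrightarrow> \<exists>d\<in>D. dist y d < e"
    using countable_dense by metis
  have ne: "x ` {1..N} \<noteq> {}" for x :: "nat \<Rightarrow> 'a"
    using assms by auto
  have eq: "covering_radius (x ` {1..N}) UNIV = (SUP y\<in>D. infdist y (x ` {1..N}))"
    for x :: "nat \<Rightarrow> 'a"
    unfolding covering_radius_eq_SUP_infdist[OF ne]
  proof (rule antisym)
    have bdd: "bdd_above ((\<lambda>y. infdist y (x ` {1..N})) ` D)"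
      using bdd_above_infdist[OF ne] by (rule bdd_above_mono) auto
    show "(SUP y. infdist y (x ` {1..N})) \<le> (SUP y\<in>D. infdist y (x ` {1..N}))"
    proof (rule cSUP_least)
      fix y :: 'a
      show "infdist y (x ` {1..N}) \<le> (SUP y\<in>D. infdist y (x ` {1..N}))"
      proof (rule field_le_epsilon)
        fix e :: real assume "0 < e"
        then obtain d where d: "d \<in> D" "dist y d < e" using D(3) by blast
        have "infdist y (x ` {1..N}) \<le> infdist d (x ` {1..N}) + dist y d"
          by (rule infdist_triangle)
        also have "\<dots> \<le> (SUP y\<in>D. infdist y (x ` {1..N})) + e"
          using d by (intro add_mono cSUP_upper bdd) auto
        finally show "infdist y (x ` {1..N}) \<le> (SUP y\<in>D. infdist y (x ` {1..N})) + e" .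
      qed
    qed simp
    show "(SUP y\<in>D. infdist y (x ` {1..N})) \<le> (SUP y. infdist y (x ` {1..N}))"
      by (rule cSUP_subset_mono) (use D bdd_above_infdist[OF ne] in auto)
  qed
  have dist_meas: "(\<lambda>x. dist y (x i)) \<in> borel_measurable (PiM {1..N} (\<lambda>_. M))"
    if "i \<in> {1..N}" for y :: 'a and i
  proof -
    have "(\<lambda>u. dist y u) \<in> borel_measurable M"
      unfolding measurable_cong_sets[OF sets_M refl]
      by (intro borel_measurable_continuous_onI continuous_intros)
    then show ?thesis
      using that by (rule measurable_compose[OF measurable_component_singleton, rotated])
  qed
  have "(\<lambda>x. infdist y (x ` {1..N})) \<in> borel_measurable (PiM {1..N} (\<lambda>_. M))" for y :: 'a
  proof -
    have "infdist y (x ` {1..N}) = (INF i\<in>{1..N}. dist y (x i))" for x :: "nat \<Rightarrow> 'a"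
      using ne[of x] by (simp add: infdist_def image_image)
    then show ?thesis
      by (simp only:) (intro borel_measurable_cINF dist_meas, auto)
  qed
  moreover have "bdd_above ((\<lambda>y. infdist y (x ` {1..N})) ` D)" for x :: "nat \<Rightarrow> 'a"
    using bdd_above_infdist[OF ne] by (rule bdd_above_mono) auto
  ultimately show ?thesis
    unfolding eq using D(1) by (intro borel_measurable_cSUP)
qed

text \<open>
  The event that no sample point falls into \<open>B\<close> is a box, so its probability is a product.
\<close>

lemma
  assumes B: "B \<in> sets borel"
  shows sets_missed: "(\<Pi>\<^sub>E i\<in>{1..N}. - B) \<in> sets (PiM {1..N} (\<lambda>_. M))"
    and measure_missed: "measure (PiM {1..N} (\<lambda>_. M)) (\<Pi>\<^sub>E i\<in>{1..N}. - B) = (1 - prob B) ^ N"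
proof -
  interpret P: finite_product_prob_space "\<lambda>_. M" "{1..N}"
    by unfold_locales auto
  have B': "- B \<in> sets M" "B \<in> sets M" using B by (auto simp: sets_M)
  show "(\<Pi>\<^sub>E i\<in>{1..N}. - B) \<in> sets (PiM {1..N} (\<lambda>_. M))"
    by (rule sets_PiM_I_finite) (use B' in auto)
  show "measure (PiM {1..N} (\<lambda>_. M)) (\<Pi>\<^sub>E i\<in>{1..N}. - B) = (1 - prob B) ^ N"
    using P.prob_times[of "\<lambda>_. - B"] B' prob_compl[of B] by (simp add: Compl_eq_Diff_UNIV)
qed

section \<open>Tails of the covering radius at a fixed scale\<close>

text \<open>
  If each of the balls of radius \<open>r\<close> about a maximal separated set contains a sample point, then each
  point \<open>y\<close> is within \<open>2 * r\<close> of a centre and hence within \<open>3 * r\<close> of a sample point.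
  By \<open>separated_card_le\<close> there are at most \<open>1 / p\<close> such balls, and the union bound applies.
\<close>

lemma prob_covering_radius_gt:
  assumes N: "1 \<le> N" and "0 < r" "0 < p" and p: "\<And>x. p \<le> prob (cball x r)"
  shows "measure (PiM {1..N} (\<lambda>_. M)) {x \<in> space (PiM {1..N} (\<lambda>_. M)). 3 * r < covering_radius (x ` {1..N}) UNIV}
      \<le> (1 - p) ^ N / p"
proof -
  let ?P = "PiM {1..N} (\<lambda>_. M)"
  interpret P: finite_product_prob_space "\<lambda>_. M" "{1..N}"
    by unfold_locales auto
  obtain Z :: "'a set" where Z: "finite Z" "\<And>z w. z \<in> Z \<Longrightarrow> w \<in> Z \<Longrightarrow> z \<noteq> w \<Longrightarrow> 2 * r < dist z w"
    "\<And>y. \<exists>z\<in>Z. dist y z \<le> 2 * r"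
    using maximal_separated_set[OF \<open>0 < r\<close>] by metis
  define missed where "missed = (\<lambda>z::'a. \<Pi>\<^sub>E i\<in>{1..N}. - cball z r)"
  have missed: "missed z \<in> sets ?P" "P.prob (missed z) = (1 - prob (cball z r)) ^ N" for z
    unfolding missed_def by (rule sets_missed measure_missed; simp)+
  have sub: "{x \<in> space ?P. 3 * r < covering_radius (x ` {1..N}) UNIV} \<subseteq> (\<Union>z\<in>Z. missed z)"
  proof (rule subsetI, rule ccontr)
    fix x assume x: "x \<in> {x \<in> space ?P. 3 * r < covering_radius (x ` {1..N}) UNIV}" "x \<notin> (\<Union>z\<in>Z. missed z)"
    have "covering_radius (x ` {1..N}) UNIV \<le> 3 * r"
    proof (subst covering_radius_eq_SUP_infdist)
      show "x ` {1..N} \<noteq> {}" using N by simp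
      show "(SUP y. infdist y (x ` {1..N})) \<le> 3 * r"
      proof (rule cSUP_least)
        fix y :: 'a
        obtain z where z: "z \<in> Z" "dist y z \<le> 2 * r" using Z(3) by blast
        then obtain i where i: "i \<in> {1..N}" "dist z (x i) \<le> r"
          using x by (fastforce simp: missed_def space_PiM PiE_iff)
        have "infdist y (x ` {1..N}) \<le> dist y (x i)"
          using i by (intro infdist_le) auto
        also have "\<dots> \<le> 3 * r"
          using dist_triangle[of y "x i" z] z i by linarith
        finally show "infdist y (x ` {1..N}) \<le> 3 * r" .
      qed simp
    qed
    then show False using x by simp
  qed
  have "P.prob {x \<in> space ?P. 3 * r < covering_radius (x ` {1..N}) UNIV} \<le> P.prob (\<Union>z\<in>Z. missed z)"
    using sub Z(1) missed by (intro P.finite_measure_mono) auto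
  also have "\<dots> \<le> (\<Sum>z\<in>Z. P.prob (missed z))"
    using Z(1) missed by (intro P.finite_measure_subadditive_finite) auto
  also have "\<dots> \<le> (\<Sum>z\<in>Z. (1 - p) ^ N)"
    unfolding missed(2) by (intro sum_mono power_mono) (auto simp: p)
  also have "\<dots> = (card Z * p) * (1 - p) ^ N / p"
    using \<open>0 < p\<close> by simp
  also have "\<dots> \<le> 1 * (1 - p) ^ N / p"
    using \<open>0 < p\<close> separated_card_le[OF Z(1,2) p] order_trans[OF p prob_le_1]
    by (intro divide_right_mono mult_right_mono zero_le_power) auto
  finally show ?thesis by simp
qed

text \<open>
  A maximal separated set has at least \<open>1 / q\<close> elements, as the balls of radius \<open>2 * r\<close> about
  it cover the space.  If a ball of radius \<open>r\<close> about one of them contains no sample point, then its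
  centre witnesses that the covering radius is at least \<open>r\<close>.  Each ball is missed
  with probability at least \<open>(1 - p) ^ N\<close>, so the second moment method bounds the probability that
  none is missed.
\<close>

lemma prob_covering_radius_less:
  assumes N: "1 \<le> N" and "0 < r" "p < 1"
    and p: "\<And>x. prob (cball x r) \<le> p" and q: "\<And>x. prob (cball x (2 * r)) \<le> q"
  shows "measure (PiM {1..N} (\<lambda>_. M)) {x \<in> space (PiM {1..N} (\<lambda>_. M)). covering_radius (x ` {1..N}) UNIV < r}
      \<le> q / (1 - p) ^ N"
proof -
  let ?P = "PiM {1..N} (\<lambda>_. M)"
  interpret P: finite_product_prob_space "\<lambda>_. M" "{1..N}"
    by unfold_locales auto
  obtain Z :: "'a set" where Z: "finite Z" "\<And>z w. z \<in> Z \<Longrightarrow> w \<in> Z \<Longrightarrow> z \<noteq> w \<Longrightarrow> 2 * r < dist z w"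
    "\<And>y. \<exists>z\<in>Z. dist y z \<le> 2 * r"
    using maximal_separated_set[OF \<open>0 < r\<close>] by metis
  define missed where "missed = (\<lambda>z::'a. \<Pi>\<^sub>E i\<in>{1..N}. - cball z r)"
  have missed: "missed z \<in> sets ?P" "P.prob (missed z) = (1 - prob (cball z r)) ^ N" for z
    unfolding missed_def by (rule sets_missed measure_missed; simp)+
  have "1 = prob (\<Union>z\<in>Z. cball z (2 * r))"
    using Z(3) prob_space by (metis (mono_tags, lifting) UNIV_eq_I UN_iff dist_commute mem_cball space_M)
  also have "\<dots> \<le> (\<Sum>z\<in>Z. prob (cball z (2 * r)))"
    using Z(1) by (intro finite_measure_subadditive_finite) (auto simp: sets_M)
  also have "\<dots> \<le> (\<Sum>z\<in>Z. q)"
    by (intro sum_mono q)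
  finally have card_q: "1 \<le> card Z * q" by simp
  then have q_pos: "0 < q" by (metis mult_nonneg_nonpos of_nat_0_le_iff not_le not_one_le_zero order_trans)
  have card_pos: "0 < real (card Z)" using card_q by (cases "card Z") auto
  have sum_ge: "card Z * (1 - p) ^ N \<le> (\<Sum>z\<in>Z. P.prob (missed z))"
    unfolding missed(2) using \<open>p < 1\<close> p by (intro sum_bounded_below power_mono) auto
  have pow_pos: "0 < (1 - p) ^ N" using \<open>p < 1\<close> by simp
  have sum_pos: "0 < (\<Sum>z\<in>Z. P.prob (missed z))"
    using sum_ge mult_pos_pos[OF card_pos pow_pos] by linarith
  have "P.prob {x \<in> space ?P. covering_radius (x ` {1..N}) UNIV < r} \<le> P.prob (space ?P - (\<Union>z\<in>Z. missed z))"
  proof (rule P.finite_measure_mono)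
    show "{x \<in> space ?P. covering_radius (x ` {1..N}) UNIV < r} \<subseteq> space ?P - (\<Union>z\<in>Z. missed z)"
    proof clarsimp
      fix x z assume x: "covering_radius (x ` {Suc 0..N}) UNIV < r" "z \<in> Z" "x \<in> missed z"
      have "r \<le> infdist z (x ` {1..N})"
        unfolding infdist_def using x N by (auto intro!: cINF_greatest simp: missed_def PiE_iff less_imp_le not_le)
      also have "\<dots> \<le> covering_radius (x ` {1..N}) UNIV"
        using N by (intro infdist_le_covering_radius) auto
      finally show False using x by simp
    qed
    show "space ?P - (\<Union>z\<in>Z. missed z) \<in> P.events"
      using Z(1) missed by auto
  qed
  also have "\<dots> \<le> 1 / (\<Sum>z\<in>Z. P.prob (missed z))"
  proof (rule P.prob_no_event_le[OF Z(1) missed(1) _ sum_pos])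
    fix z w assume zw: "z \<in> Z" "w \<in> Z" "z \<noteq> w"
    have disj: "cball z r \<inter> cball w r = {}"
      using Z(2)[OF zw] by (intro disjoint_cballI) simp
    have un: "prob (cball z r \<union> cball w r) = prob (cball z r) + prob (cball w r)"
      using disj by (intro finite_measure_Union) (auto simp: sets_M)
    \<comment> \<open>The correlation is negative since \<open>1 - u - v \<le> (1 - u) * (1 - v)\<close> for nonnegative \<open>u\<close>, \<open>v\<close>.\<close>
    have "missed z \<inter> missed w = (\<Pi>\<^sub>E i\<in>{1..N}. - (cball z r \<union> cball w r))"
      unfolding missed_def by (simp add: PiE_Int)
    then have "P.prob (missed z \<inter> missed w) = (1 - prob (cball z r \<union> cball w r)) ^ N"
      by (simp only:) (rule measure_missed, auto)
    also have "\<dots> \<le> ((1 - prob (cball z r)) * (1 - prob (cball w r))) ^ N"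
      using prob_le_1[of "cball z r \<union> cball w r"]
      by (intro power_mono) (auto simp: un algebra_simps)
    finally show "P.prob (missed z \<inter> missed w) \<le> P.prob (missed z) * P.prob (missed w)"
      by (simp only: missed(2) power_mult_distrib)
  qed
  also have "\<dots> \<le> 1 / (card Z * (1 - p) ^ N)"
    by (intro divide_left_mono sum_ge mult_pos_pos sum_pos card_pos pow_pos) simp
  also have "\<dots> \<le> q / (1 - p) ^ N"
    using card_q card_pos pow_pos q_pos \<open>p < 1\<close> by (simp add: field_simps)
  finally show ?thesis .
qed

end

section \<open>The scale of the covering radius\<close>

text \<open>
  The bound \<open>\<Phi> r \<le> r powr \<sigma>\<close> has two uses.  It makes \<open>\<Phi>\<close> tend to 0 at 0, so that the
  intermediate value theorem puts every small positive \<open>t\<close> into the range of \<open>\<Phi>\<close>.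
  Read at \<open>r = pos_inv \<Phi> t\<close>, it bounds the inverse from below by a power.
\<close>

lemma pos_inv_near_0:
  assumes cont: "continuous_on {0<..} \<Phi>"
    and nonneg: "\<And>r. 0 < r \<Longrightarrow> 0 \<le> \<Phi> r"
    and mono: "strict_mono_on {0<..} \<Phi>"
    and r0: "0 < r0" and sigma: "0 < \<sigma>"
    and power_bound: "\<And>r. 0 < r \<Longrightarrow> r < r0 \<Longrightarrow> \<Phi> r \<le> r powr \<sigma>"
    and delta: "0 < \<delta>"
  shows "\<forall>\<^sub>F t in at_right 0. 0 < pos_inv \<Phi> t \<and> pos_inv \<Phi> t < \<delta> \<and> \<Phi> (pos_inv \<Phi> t) = t
            \<and> t powr (1 / \<sigma>) \<le> pos_inv \<Phi> t"
proof -
  define d where "d = min \<delta> r0"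
  have d: "0 < d" "d \<le> \<delta>" "d \<le> r0" using delta r0 by (auto simp: d_def)
  have "\<Phi> (d / 2) < \<Phi> d" using mono d by (auto simp: strict_mono_on_def)
  then have "0 < \<Phi> d" using nonneg[of "d / 2"] d by simp
  then have "\<forall>\<^sub>F t in at_right 0. 0 < t \<and> t < \<Phi> d"
    by (auto simp: eventually_at_right_field)
  then show ?thesis
  proof eventually_elim
    case (elim t)
    define s where "s = min (d / 2) ((t / 2) powr (1 / \<sigma>))"
    have s: "0 < s" "s < d" using d elim by (auto simp: s_def)
    have "\<Phi> s \<le> s powr \<sigma>" using s d by (intro power_bound) auto
    also have "\<dots> \<le> ((t / 2) powr (1 / \<sigma>)) powr \<sigma>"
      using s sigma by (intro powr_mono2) (auto simp: s_def)
    also have "\<dots> = t / 2" using elim sigma by (simp add: powr_powr)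
    finally have "\<Phi> s \<le> t" using elim by simp
    then obtain r where r: "s \<le> r" "r \<le> d" "\<Phi> r = t"
      using IVT'[of \<Phi> s t d] s elim continuous_on_subset[OF cont, of "{s..d}"]
      by (auto simp: subset_iff less_le_trans)
    have inv: "pos_inv \<Phi> t = r"
      unfolding pos_inv_def using r s strict_mono_on_imp_inj_on[OF mono]
      by (intro inv_into_f_eq) auto
    have "r < d" using r elim by (cases "r = d") auto
    moreover have "t powr (1 / \<sigma>) \<le> r"
    proof -
      have "t powr (1 / \<sigma>) \<le> (r powr \<sigma>) powr (1 / \<sigma>)"
        using power_bound[of r] r s d \<open>r < d\<close> elim sigma by (intro powr_mono2) auto
      also have "\<dots> = r" using r s sigma by (simp add: powr_powr)
      finally show ?thesis .
    qed
    ultimately show ?case using r s d inv by simp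
  qed
qed

text \<open>
  The fixed-scale bounds at \<open>\<Phi> r = \<kappa> * ln N / N\<close>.  With \<open>\<kappa> = s / a\<close> a ball is missed with
  probability at most \<open>N powr (- s)\<close>, so the upper tail is at most \<open>N powr (1 - s)\<close>, and
  \<open>s = 2 + 1 / \<sigma>\<close> makes this smaller than \<open>r\<close> by a factor of order \<open>N\<close> or more.
  With \<open>\<kappa>' = 1 / (4 * A)\<close> a ball is missed with probability at least \<open>N powr (- 1 / 2)\<close>, which is
  beaten by the number of balls, of order \<open>N / ln N\<close>.
\<close>

lemma (in charged_balls) covering_radius_two_sided:
  fixes \<Phi> :: "real \<Rightarrow> real"
  assumes cont: "continuous_on {0<..} \<Phi>"
    and nonneg: "\<And>r. 0 < r \<Longrightarrow> 0 \<le> \<Phi> r"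
    and mono: "strict_mono_on {0<..} \<Phi>"
    and doubling: "\<forall>\<^sub>F r in at_right 0. \<Phi> (2 * r) \<le> K * \<Phi> r"
    and r0: "0 < r0" and sigma: "0 < \<sigma>"
    and power_bound: "\<And>r. 0 < r \<Longrightarrow> r < r0 \<Longrightarrow> \<Phi> r \<le> r powr \<sigma>"
    and a: "0 < a" and A: "0 < A"
    and lower: "\<And>x r. 0 < r \<Longrightarrow> r < r0 \<Longrightarrow> a * \<Phi> r \<le> prob (cball x r)"
    and upper: "\<And>x r. 0 < r \<Longrightarrow> r < r0 \<Longrightarrow> prob (cball x r) \<le> A * \<Phi> r"
  obtains \<kappa> \<kappa>' :: real and f g :: "nat \<Rightarrow> real" where "0 < \<kappa>" "0 < \<kappa>'" "f \<longlonglongrightarrow> 0" "g \<longlonglongrightarrow> 0"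
    "\<forall>\<^sub>F N in sequentially. 0 < pos_inv \<Phi> (\<kappa> * (ln N / N)) \<and>
       diameter (UNIV :: 'a set) * f N \<le> pos_inv \<Phi> (\<kappa> * (ln N / N)) \<and>
       measure (PiM {1..N} (\<lambda>_. M)) {x \<in> space (PiM {1..N} (\<lambda>_. M)).
         3 * pos_inv \<Phi> (\<kappa> * (ln N / N)) < covering_radius (x ` {1..N}) UNIV} \<le> f N"
    "\<forall>\<^sub>F N in sequentially. 0 < pos_inv \<Phi> (\<kappa>' * (ln N / N)) \<and>
       measure (PiM {1..N} (\<lambda>_. M)) {x \<in> space (PiM {1..N} (\<lambda>_. M)).
         covering_radius (x ` {1..N}) UNIV < pos_inv \<Phi> (\<kappa>' * (ln N / N))} \<le> g N"
proof -
  define s where "s = 2 + 1 / \<sigma>"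
  define \<kappa> where "\<kappa> = s / a"
  define \<kappa>' where "\<kappa>' = 1 / (4 * A)"
  define f :: "nat \<Rightarrow> real" where "f = (\<lambda>N. real N powr (1 - s))"
  define g :: "nat \<Rightarrow> real" where "g = (\<lambda>N. K / 4 * (ln N * N powr (- 1 / 2)))"
  have s: "2 < s" using sigma by (simp add: s_def)
  have kappa: "0 < \<kappa>" "0 < \<kappa>'" using s a A by (auto simp: \<kappa>_def \<kappa>'_def)
  have f_lim: "f \<longlonglongrightarrow> 0" unfolding f_def using s by real_asymp
  have "(\<lambda>N::nat. ln N * N powr (- 1 / 2)) \<longlonglongrightarrow> 0" by real_asymp
  then have g_lim: "g \<longlonglongrightarrow> 0" unfolding g_def by (rule tendsto_mult_right_zero)
  obtain b where b: "0 < b" "\<And>r. 0 < r \<Longrightarrow> r < b \<Longrightarrow> \<Phi> (2 * r) \<le> K * \<Phi> r"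
    using doubling by (auto simp: eventually_at_right_field)
  define \<delta> where "\<delta> = min b (r0 / 2)"
  have delta: "0 < \<delta>" "\<delta> \<le> b" "\<delta> \<le> r0 / 2" using b r0 by (auto simp: \<delta>_def)
  have scale: "\<forall>\<^sub>F N in sequentially. 0 < pos_inv \<Phi> (k * (ln N / N)) \<and> pos_inv \<Phi> (k * (ln N / N)) < \<delta>
      \<and> \<Phi> (pos_inv \<Phi> (k * (ln N / N))) = k * (ln N / N)
      \<and> (k * (ln N / N)) powr (1 / \<sigma>) \<le> pos_inv \<Phi> (k * (ln N / N))" if "0 < k" for k
  proof -
    have "filterlim (\<lambda>N::nat. k * (ln N / N)) (at_right 0) sequentially"
      using that by real_asymp
    with pos_inv_near_0[OF cont nonneg mono r0 sigma power_bound delta(1)] show ?thesis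
      by (rule eventually_compose_filterlim)
  qed
  show thesis
  proof (rule that[OF kappa f_lim g_lim])
    have "\<forall>\<^sub>F N in sequentially. diameter (UNIV :: 'a set) / \<kappa> powr (1 / \<sigma>) \<le> real N"
      by real_asymp
    moreover have "\<forall>\<^sub>F N in sequentially. 1 \<le> ln (real N)" by real_asymp
    moreover have "\<forall>\<^sub>F N::nat in sequentially. 2 \<le> N" by (rule eventually_ge_at_top)
    moreover note scale[OF kappa(1)]
    ultimately show "\<forall>\<^sub>F N in sequentially. 0 < pos_inv \<Phi> (\<kappa> * (ln N / N)) \<and>
       diameter (UNIV :: 'a set) * f N \<le> pos_inv \<Phi> (\<kappa> * (ln N / N)) \<and>
       measure (PiM {1..N} (\<lambda>_. M)) {x \<in> space (PiM {1..N} (\<lambda>_. M)).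
         3 * pos_inv \<Phi> (\<kappa> * (ln N / N)) < covering_radius (x ` {1..N}) UNIV} \<le> f N"
    proof eventually_elim
      case (elim N)
      define t where "t = \<kappa> * (ln N / N)"
      define r where "r = pos_inv \<Phi> t"
      have r: "0 < r" "r < \<delta>" "\<Phi> r = t" "t powr (1 / \<sigma>) \<le> r" and N: "2 \<le> N" "1 \<le> ln (real N)"
        using elim by (auto simp: r_def t_def)
      have t: "0 < t" using kappa N unfolding t_def by (intro mult_pos_pos divide_pos_pos) auto
      have at: "a * t = s * ln N / N" using a by (simp add: t_def \<kappa>_def)
      have ball: "a * t \<le> prob (cball x r)" for x
        using lower[of r x] r delta r0 by auto
      have "diameter (UNIV :: 'a set) * f N \<le> (\<kappa> powr (1 / \<sigma>) * real N) * f N"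
        using elim(1) kappa by (intro mult_right_mono) (auto simp: f_def field_simps)
      also have "\<dots> = (\<kappa> / N) powr (1 / \<sigma>)"
        using N kappa by (simp add: f_def s_def powr_divide powr_diff powr_minus powr_add field_simps power2_eq_square)
      also have "\<dots> \<le> t powr (1 / \<sigma>)"
        using kappa N sigma by (intro powr_mono2) (auto simp: t_def field_simps)
      finally have diam: "diameter (UNIV :: 'a set) * f N \<le> r" using r by linarith
      have "measure (PiM {1..N} (\<lambda>_. M)) {x \<in> space (PiM {1..N} (\<lambda>_. M)).
         3 * r < covering_radius (x ` {1..N}) UNIV} \<le> (1 - a * t) ^ N / (a * t)"
        using N r t a ball by (intro prob_covering_radius_gt) auto
      also have "\<dots> \<le> exp (- (a * t)) ^ N / (a * t)"
        using a t order_trans[OF ball prob_le_1] exp_ge_add_one_self[of "- (a * t)"]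
        by (intro divide_right_mono power_mono) auto
      also have "\<dots> = real N powr (- s) / (a * t)"
        using N at by (simp add: exp_of_nat_mult[symmetric] powr_def)
      also have "\<dots> \<le> real N powr (- s) / (1 / N)"
        \<comment> \<open>\<open>a * t = s * ln N / N\<close> exceeds \<open>1 / N\<close>, as \<open>s > 1\<close> and \<open>ln N \<ge> 1\<close>.\<close>
        using N s at a t mult_mono[of 1 s 1 "ln (real N)"]
        by (intro divide_left_mono mult_pos_pos) (auto intro!: divide_right_mono)
      also have "\<dots> = f N"
        using N by (simp add: f_def powr_diff powr_minus field_simps)
      finally show ?case using diam r by (simp add: r_def t_def)
    qed
    have "\<forall>\<^sub>F N in sequentially. ln (real N) / N \<le> 2" by real_asymp
    moreover have "\<forall>\<^sub>F N::nat in sequentially. 2 \<le> N" by (rule eventually_ge_at_top)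
    moreover note scale[OF kappa(2)]
    ultimately show "\<forall>\<^sub>F N in sequentially. 0 < pos_inv \<Phi> (\<kappa>' * (ln (real N) / real N)) \<and>
       measure (PiM {1..N} (\<lambda>_. M)) {x \<in> space (PiM {1..N} (\<lambda>_. M)).
         covering_radius (x ` {1..N}) UNIV < pos_inv \<Phi> (\<kappa>' * (ln (real N) / real N))} \<le> g N"
    proof eventually_elim
      case (elim N)
      define t where "t = \<kappa>' * (ln (real N) / real N)"
      define r where "r = pos_inv \<Phi> t"
      have r: "0 < r" "r < \<delta>" "\<Phi> r = t" and N: "2 \<le> N"
        using elim by (auto simp: r_def t_def)
      have t: "0 < t" using kappa N by (simp add: t_def)
      have At: "A * t = ln N / N / 4" using A by (simp add: t_def \<kappa>'_def)
      have half: "A * t \<le> 1 / 2" using elim(1) At by simp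
      have double: "prob (cball x (2 * r)) \<le> A * (K * t)" for x
      proof -
        have "prob (cball x (2 * r)) \<le> A * \<Phi> (2 * r)"
          using r delta by (intro upper) auto
        also have "\<dots> \<le> A * (K * t)"
          using b(2)[of r] r delta A by (intro mult_left_mono) auto
        finally show ?thesis .
      qed
      have "measure (PiM {1..N} (\<lambda>_. M)) {x \<in> space (PiM {1..N} (\<lambda>_. M)).
         covering_radius (x ` {1..N}) UNIV < r} \<le> A * (K * t) / (1 - A * t) ^ N"
        using N r delta r0 half upper[of r] double by (intro prob_covering_radius_less) auto
      also have "\<dots> \<le> A * (K * t) / exp (- 2 * (A * t)) ^ N"
      proof -
        have "0 \<le> A * (K * t)"
          using double order_trans measure_nonneg by blast
        moreover have "exp (- 2 * (A * t)) \<le> 1 - A * t"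
          using half A t by (intro exp_minus_double_le) auto
        ultimately show ?thesis
          using half by (intro divide_left_mono power_mono mult_pos_pos) auto
      qed
      also have "exp (- 2 * (A * t)) ^ N = real N powr (- 1 / 2)"
        using N by (simp add: exp_of_nat_mult[symmetric] powr_def At)
      also have "A * (K * t) = K * (A * t)" by simp
      also have "\<dots> = K / 4 * ln N * (1 / N)" by (simp add: At)
      also have "1 / real N = real N powr (- 1 / 2) * real N powr (- 1 / 2)"
        using N by (simp add: powr_add[symmetric] powr_minus_divide)
      also have "K / 4 * ln N * (real N powr (- 1 / 2) * real N powr (- 1 / 2)) / real N powr (- 1 / 2) = g N"
        using N by (simp add: g_def)
      finally show ?case using r by (simp add: r_def t_def)
    qed
  qed
qed

section \<open>Two-sided bounds in probability and in expectation\<close>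

theorem corollary2p3:
  fixes \<mu> :: "'a::metric_space measure"
    and \<Phi> :: "real \<Rightarrow> real"
    and r0 \<sigma> c C :: real
  assumes borel: "sets \<mu> = sets borel"
    and finite: "finite_measure \<mu>"
    and support: "\<And>U. open U \<Longrightarrow> U \<noteq> {} \<Longrightarrow> 0 < emeasure \<mu> U"
    and cont: "continuous_on {0<..} \<Phi>"
    and nonneg: "\<And>r. 0 < r \<Longrightarrow> 0 \<le> \<Phi> r"
    and mono: "strict_mono_on {0<..} \<Phi>"
    and doubling: "strictly_doubling \<Phi>"
    and r0: "0 < r0"
    and sigma: "0 < \<sigma>"
    and power_bound: "\<And>r. 0 < r \<Longrightarrow> r < r0 \<Longrightarrow> \<Phi> r \<le> r powr \<sigma>"
    and c: "0 < c"
    and C: "0 < C"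
    and ball_lower: "\<And>x r. 0 < r \<Longrightarrow> r < r0 \<Longrightarrow> c * \<Phi> r \<le> measure \<mu> (cball x r)"
    and ball_upper: "\<And>x r. 0 < r \<Longrightarrow> r < r0 \<Longrightarrow> measure \<mu> (cball x r) \<le> C * \<Phi> r"
  shows "(\<exists>c1>0. \<exists>c2>0. \<exists>c3>0. \<exists>c4>0. \<forall>\<epsilon>>0. \<exists>N\<epsilon>::nat. \<forall>N>N\<epsilon>.
            \<P>(x in random_points \<mu> N.
                c1 * pos_inv \<Phi> (c2 * (ln (real N) / real N)) \<le> covering_radius (x ` {1..N}) UNIV \<and>
                covering_radius (x ` {1..N}) UNIV \<le> c3 * pos_inv \<Phi> (c4 * (ln (real N) / real N)))
            > 1 - \<epsilon>) \<and>
         (\<exists>C1>0. \<exists>C2>0. \<exists>C3>0. \<exists>C4>0. \<forall>\<^sub>F N in sequentially.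
            C1 * pos_inv \<Phi> (C2 * (ln (real N) / real N))
              \<le> (\<integral>x. covering_radius (x ` {1..N}) UNIV \<partial>random_points \<mu> N) \<and>
            (\<integral>x. covering_radius (x ` {1..N}) UNIV \<partial>random_points \<mu> N)
              \<le> C3 * pos_inv \<Phi> (C4 * (ln (real N) / real N)))"
proof -
  interpret \<mu>: finite_measure \<mu> by (rule finite)
  have space_\<mu>: "space \<mu> = UNIV" using sets_eq_imp_space_eq[OF borel] by simp
  define m where "m = measure \<mu> UNIV"
  define \<nu> where "\<nu> = scale_measure (inverse (emeasure \<mu> (space \<mu>))) \<mu>"
  have "0 < emeasure \<mu> (UNIV :: 'a set)" by (rule support) auto
  then have m: "0 < m" unfolding m_def by (simp add: \<mu>.emeasure_eq_measure)
  have \<nu>_eq: "\<nu> = scale_measure (ennreal (1 / m)) \<mu>"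
    using m by (simp add: \<nu>_def space_\<mu> \<mu>.emeasure_eq_measure m_def inverse_ennreal inverse_eq_divide)
  have measure_\<nu>: "measure \<nu> B = measure \<mu> B / m" for B
    using m by (simp add: measure_def \<nu>_eq enn2real_mult)
  have \<Phi>_pos: "0 < \<Phi> r" if "0 < r" for r
    using nonneg[of "r / 2"] strict_mono_onD[OF mono, of "r / 2" r] that by simp
  interpret \<nu>: prob_space \<nu>
  proof
    show "emeasure \<nu> (space \<nu>) = 1"
      using m by (simp add: \<nu>_eq space_scale_measure space_\<mu> \<mu>.emeasure_eq_measure m_def[symmetric]
          ennreal_mult[symmetric])
  qed
  interpret \<nu>: charged_balls \<nu>
  proof
    show "sets \<nu> = sets borel" by (simp add: \<nu>_def borel)
    fix r :: real assume "0 < r"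
    define s where "s = min r (r0 / 2)"
    have s: "0 < s" "s < r0" "s \<le> r" using \<open>0 < r\<close> r0 by (auto simp: s_def)
    have "c * \<Phi> s / m \<le> measure \<nu> (cball x r)" for x
    proof -
      have "c * \<Phi> s \<le> measure \<mu> (cball x s)" by (rule ball_lower[OF s(1,2)])
      also have "\<dots> \<le> measure \<mu> (cball x r)"
        using s by (intro \<mu>.finite_measure_mono) (auto simp: borel)
      finally show ?thesis using m by (simp add: measure_\<nu> divide_right_mono)
    qed
    moreover have "0 < c * \<Phi> s / m" using c m \<Phi>_pos s by simp
    ultimately show "\<exists>p>0. \<forall>x. p \<le> measure \<nu> (cball x r)" by blast
  qed
  define P where "P = random_points \<mu>"
  have P_eq: "P N = PiM {1..N} (\<lambda>_. \<nu>)" for N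
    by (simp add: P_def random_points_def \<nu>_def)
  have prob_P: "prob_space (P N)" for N
    unfolding P_eq by (intro prob_space_PiM \<nu>.prob_space_axioms)
  define \<rho> where "\<rho> = (\<lambda>(N::nat) x. covering_radius (x ` {1..N}) (UNIV :: 'a set))"
  obtain K where K: "\<forall>\<^sub>F r in at_right 0. \<Phi> (2 * r) \<le> K * \<Phi> r"
  proof -
    obtain C2 where "\<forall>\<^sub>F r in at_right 0. \<Phi> (2 * r) \<le> C2 * \<Phi> r"
      using doubling unfolding strictly_doubling_def by (auto simp: eventually_conj_iff)
    then show thesis by (rule that)
  qed
  have lower: "c / m * \<Phi> r \<le> measure \<nu> (cball x r)" if "0 < r" "r < r0" for x r
    using ball_lower[OF that, of x] m by (simp add: measure_\<nu> field_simps)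
  have upper: "measure \<nu> (cball x r) \<le> C / m * \<Phi> r" if "0 < r" "r < r0" for x r
    using ball_upper[OF that, of x] m by (simp add: measure_\<nu> field_simps)
  define D where "D = diameter (UNIV :: 'a set)"
  obtain \<kappa> \<kappa>' :: real and f g :: "nat \<Rightarrow> real"
    where kappa: "0 < \<kappa>" "0 < \<kappa>'"
    and lims: "f \<longlonglongrightarrow> 0" "g \<longlonglongrightarrow> 0"
    and above: "\<forall>\<^sub>F N in sequentially. 0 < pos_inv \<Phi> (\<kappa> * (ln (real N) / real N)) \<and>
       D * f N \<le> pos_inv \<Phi> (\<kappa> * (ln (real N) / real N)) \<and>
       measure (P N) {x \<in> space (P N). 3 * pos_inv \<Phi> (\<kappa> * (ln (real N) / real N)) < \<rho> N x} \<le> f N"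
    and below: "\<forall>\<^sub>F N in sequentially. 0 < pos_inv \<Phi> (\<kappa>' * (ln (real N) / real N)) \<and>
       measure (P N) {x \<in> space (P N). \<rho> N x < pos_inv \<Phi> (\<kappa>' * (ln (real N) / real N))} \<le> g N"
    unfolding P_eq \<rho>_def D_def
    by (rule \<nu>.covering_radius_two_sided[OF cont nonneg mono K r0 sigma power_bound _ _ lower upper])
       (use c C m in auto)
  have \<rho>_meas: "\<rho> N \<in> borel_measurable (P N)" if "1 \<le> N" for N
    unfolding \<rho>_def P_eq by (rule \<nu>.covering_radius_measurable[OF that])
  have \<rho>_bounds: "0 \<le> \<rho> N x" "\<rho> N x \<le> D" if "1 \<le> N" for N x
    unfolding \<rho>_def D_def using that
    by (auto intro!: \<nu>.covering_radius_nonneg \<nu>.covering_radius_le_diameter)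
  have \<rho>_int: "integrable (P N) (\<rho> N)" if "1 \<le> N" for N
  proof -
    interpret P: prob_space "P N" by (rule prob_P)
    show ?thesis
      by (rule P.integrable_const_bound[of _ D]) (use that \<rho>_bounds \<rho>_meas in auto)
  qed
  have "\<exists>N\<epsilon>::nat. \<forall>N>N\<epsilon>. \<P>(x in P N. 1 * pos_inv \<Phi> (\<kappa>' * (ln (real N) / real N)) \<le> \<rho> N x \<and>
      \<rho> N x \<le> 3 * pos_inv \<Phi> (\<kappa> * (ln (real N) / real N))) > 1 - \<epsilon>" if "0 < \<epsilon>" for \<epsilon>
  proof -
    have "\<forall>\<^sub>F N in sequentially. f N < \<epsilon> / 2" "\<forall>\<^sub>F N in sequentially. g N < \<epsilon> / 2"
      using that by (intro order_tendstoD(2)[OF lims(1)] order_tendstoD(2)[OF lims(2)]; simp)+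
    moreover have "\<forall>\<^sub>F N::nat in sequentially. 1 \<le> N" by (rule eventually_ge_at_top)
    ultimately have "\<forall>\<^sub>F N in sequentially. \<P>(x in P N. 1 * pos_inv \<Phi> (\<kappa>' * (ln (real N) / real N)) \<le> \<rho> N x \<and>
      \<rho> N x \<le> 3 * pos_inv \<Phi> (\<kappa> * (ln (real N) / real N))) > 1 - \<epsilon>"
      using above below
    proof eventually_elim
      case (elim N)
      interpret P: prob_space "P N" by (rule prob_P)
      note [measurable] = \<rho>_meas[OF elim(3)]
      let ?r = "pos_inv \<Phi> (\<kappa>' * (ln (real N) / real N))" and ?R = "3 * pos_inv \<Phi> (\<kappa> * (ln (real N) / real N))"
      have "\<P>(x in P N. \<not> (?r \<le> \<rho> N x \<and> \<rho> N x \<le> ?R))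
          \<le> measure (P N) ({x \<in> space (P N). \<rho> N x < ?r} \<union> {x \<in> space (P N). ?R < \<rho> N x})"
        by (rule P.finite_measure_mono) auto
      also have "\<dots> \<le> \<P>(x in P N. \<rho> N x < ?r) + \<P>(x in P N. ?R < \<rho> N x)"
        by (rule measure_Un_le) measurable
      finally show ?case
        using elim P.prob_neg[of "\<lambda>x. ?r \<le> \<rho> N x \<and> \<rho> N x \<le> ?R"] by simp
    qed
    then show ?thesis
      unfolding eventually_sequentially by (meson less_imp_le)
  qed
  then have "\<exists>c1>0. \<exists>c2>0. \<exists>c3>0. \<exists>c4>0. \<forall>\<epsilon>>0. \<exists>N\<epsilon>::nat. \<forall>N>N\<epsilon>.
      \<P>(x in P N. c1 * pos_inv \<Phi> (c2 * (ln (real N) / real N)) \<le> \<rho> N x \<and>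
        \<rho> N x \<le> c3 * pos_inv \<Phi> (c4 * (ln (real N) / real N))) > 1 - \<epsilon>"
    using kappa zero_less_one zero_less_numeral by blast
  moreover have "\<forall>\<^sub>F N in sequentially. 1 / 2 * pos_inv \<Phi> (\<kappa>' * (ln (real N) / real N)) \<le> (\<integral>x. \<rho> N x \<partial>P N) \<and>
      (\<integral>x. \<rho> N x \<partial>P N) \<le> 4 * pos_inv \<Phi> (\<kappa> * (ln (real N) / real N))"
  proof -
    have "\<forall>\<^sub>F N in sequentially. g N < 1 / 2" by (intro order_tendstoD(2)[OF lims(2)]) simp
    moreover have "\<forall>\<^sub>F N::nat in sequentially. 1 \<le> N" by (rule eventually_ge_at_top)
    ultimately show ?thesis
      using above below
    proof eventually_elim
      case (elim N)
      interpret P: prob_space "P N" by (rule prob_P)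
      note [measurable] = \<rho>_meas[OF elim(2)]
      note int = \<rho>_int[OF elim(2)]
      define r where "r = pos_inv \<Phi> (\<kappa>' * (ln (real N) / real N))"
      define R where "R = pos_inv \<Phi> (\<kappa> * (ln (real N) / real N))"
      have rR: "0 < r" "0 < R" "D * f N \<le> R" "\<P>(x in P N. 3 * R < \<rho> N x) \<le> f N" "\<P>(x in P N. \<rho> N x < r) < 1 / 2"
        using elim by (auto simp: r_def R_def)
      \<comment> \<open>Eventually the covering radius is at least \<open>r\<close> with probability at least one half.\<close>
      have "1 / 2 * r \<le> \<P>(x in P N. \<rho> N x \<ge> r) * r"
        using rR P.prob_neg[of "\<lambda>x. \<rho> N x < r"] by (intro mult_right_mono) (auto simp: not_less)
      also have "\<dots> \<le> (\<integral>x. \<rho> N x \<partial>P N)"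
        using integral_Markov_inequality_measure[OF int, of "{}" r] rR \<rho>_bounds(1)[OF elim(2)]
        by (simp add: field_simps)
      finally have low: "1 / 2 * r \<le> (\<integral>x. \<rho> N x \<partial>P N)" .
      define B where "B = {x \<in> space (P N). 3 * R < \<rho> N x}"
      have [measurable]: "B \<in> sets (P N)" unfolding B_def by measurable
      have int_B: "integrable (P N) (\<lambda>x. D * indicator B x)"
        by (intro integrable_mult_right) (simp add: less_top[symmetric])
      have "(\<integral>x. \<rho> N x \<partial>P N) \<le> (\<integral>x. 3 * R + D * indicator B x \<partial>P N)"
      proof (rule integral_mono[OF int])
        show "integrable (P N) (\<lambda>x. 3 * R + D * indicator B x)" using int_B by simp
        show "\<rho> N x \<le> 3 * R + D * indicator B x" if "x \<in> space (P N)" for x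
          using that rR(2) \<rho>_bounds(2)[OF elim(2), of x] by (auto simp: B_def indicator_def)
      qed
      also have "\<dots> = 3 * R + D * \<P>(x in P N. 3 * R < \<rho> N x)"
        using int_B by (subst Bochner_Integration.integral_add) (auto simp: P.prob_space B_def)
      also have "\<dots> \<le> 3 * R + D * f N"
        using rR \<rho>_bounds[OF elim(2)] by (intro add_left_mono mult_left_mono) (auto intro: order_trans)
      also have "\<dots> \<le> 4 * R" using rR by simp
      finally show ?case using low by (simp add: r_def R_def)
    qed
  qed
  then have "\<exists>C1>0. \<exists>C2>0. \<exists>C3>0. \<exists>C4>0. \<forall>\<^sub>F N in sequentially.
      C1 * pos_inv \<Phi> (C2 * (ln (real N) / real N)) \<le> (\<integral>x. \<rho> N x \<partial>P N) \<and>
      (\<integral>x. \<rho> N x \<partial>P N) \<le> C3 * pos_inv \<Phi> (C4 * (ln (real N) / real N))"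
    using kappa half_gt_zero[OF zero_less_one] zero_less_numeral by blast
  ultimately show ?thesis
    unfolding P_def \<rho>_def by (rule conjI)
qed

end
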